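(* Let $\Omega\subset\mathbb{H}$ be a slice-open set, and let $\gamma:[0,1]\to\mathbb{C}$ be a path with $\gamma(0)\in\mathbb{R}$ and $\gamma^I,\gamma^J,\gamma^K\subset\Omega$ for some $I,J,K\in\mathbb{S}$ with $J\neq K$. If $f:\Omega\to\mathbb{H}$ is slice regular, then $$f\circ\gamma^I=(I-K)(J-K)^{-1}\,f\circ\gamma^J+(I-J)(K-J)^{-1}\,f\circ\gamma^K$$ as functions on $[0,1]$.
   Context: $\mathbb{H}$ denotes the quaternions and $\mathbb{S}=\{q\in\mathbb{H}: q^2=-1\}$. For $I\in\mathbb{S}$, $\mathbb{C}_I=\mathbb{R}+I\mathbb{R}$, and for $\Omega\subset\mathbb{H}$, $\Omega_I:=\Omega\cap\mathbb{C}_I$ and $f_I:=f|_{\Omega_I}$. A set $\Omega\subset\mathbb{H}$ is slice-open if $\Omega_I$ is open in $\mathbb{C}_I$ (Euclidean topology) for every $I\in\mathbb{S}$. For $U$ open in $\mathbb{C}_I$, a function $h:U\to\mathbb{H}$ is left $\mathbb{C}_I$-holomorphic if it has continuous partial derivatives and $\frac12\left(\frac{\partial}{\partial x}+I\frac{\partial}{\partial y}\right)h(x+yI)=0$ on $U$. A function $f:\Omega\to\mathbb{H}$ on a slice-open set is slice regular if $f_I$ is left $\mathbb{C}_I$-holomorphic for every $I\in\mathbb{S}$. For $I\in\mathbb{S}$, $\mathcal{P}_I:\mathbb{C}\to\mathbb{C}_I$ is $x+yi\mapsto x+yI$ ($x,y\in\mathbb{R}$), and for a path $\gamma$ in $\mathbb{C}$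 (continuous map on $[0,1]$), $\gamma^I:=\mathcal{P}_I\circ\gamma$; $\gamma^I\subset\Omega$ means that the image of $\gamma^I$ lies in $\Omega$. *)

theory Defs
  imports "HOL-Analysis.Analysis"
begin

section \<open>Quaternions\<close>

text \<open>\<open>Quat a b c d\<close> stands for \<open>a + b i + c j + d k\<close> with Hamilton's relations
  \<open>i\<^sup>2 = j\<^sup>2 = k\<^sup>2 = i j k = -1\<close>.\<close>

codatatype quat = Quat (qRe: real) (qI: real) (qJ: real) (qK: real)

lemma quat_eq_iff: "x = y \<longleftrightarrow> qRe x = qRe y \<and> qI x = qI y \<and> qJ x = qJ y \<and> qK x = qK y"
  by (auto intro: quat.expand)

instantiation quat :: ring_1
begin

primcorec zero_quat where
  "qRe 0 = 0" | "qI 0 = 0" | "qJ 0 = 0" | "qK 0 = 0"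

primcorec one_quat where
  "qRe 1 = 1" | "qI 1 = 0" | "qJ 1 = 0" | "qK 1 = 0"

primcorec plus_quat where
  "qRe (x + y) = qRe x + qRe y"
| "qI (x + y) = qI x + qI y"
| "qJ (x + y) = qJ x + qJ y"
| "qK (x + y) = qK x + qK y"

primcorec uminus_quat where
  "qRe (- x) = - qRe x" | "qI (- x) = - qI x" | "qJ (- x) = - qJ x" | "qK (- x) = - qK x"

primcorec minus_quat where
  "qRe (x - y) = qRe x - qRe y"
| "qI (x - y) = qI x - qI y"
| "qJ (x - y) = qJ x - qJ y"
| "qK (x - y) = qK x - qK y"

primcorec times_quat where
  "qRe (x * y) = qRe x * qRe y - qI x * qI y - qJ x * qJ y - qK x * qK y"
| "qI (x * y) = qRe x * qI y + qI x * qRe y + qJ x * qK y - qK x * qJ y"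
| "qJ (x * y) = qRe x * qJ y - qI x * qK y + qJ x * qRe y + qK x * qI y"
| "qK (x * y) = qRe x * qK y + qI x * qJ y - qJ x * qI y + qK x * qRe y"

instance
  by standard (simp_all add: quat_eq_iff algebra_simps)

end

instantiation quat :: real_algebra_1
begin

primcorec scaleR_quat where
  "qRe (scaleR r x) = r * qRe x"
| "qI (scaleR r x) = r * qI x"
| "qJ (scaleR r x) = r * qJ x"
| "qK (scaleR r x) = r * qK x"

instance
  by standard (simp_all add: quat_eq_iff algebra_simps)

end

instantiation quat :: real_inner
begin

definition inner_quat :: "quat \<Rightarrow> quat \<Rightarrow> real" where
  "inner_quat x y = qRe x * qRe y + qI x * qI y + qJ x * qJ y + qK x * qK y"

definition norm_quat :: "quat \<Rightarrow> real" where
  "norm_quat x = sqrt (inner x x)"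

definition sgn_quat :: "quat \<Rightarrow> quat" where
  "sgn_quat x = x /\<^sub>R norm x"

definition dist_quat :: "quat \<Rightarrow> quat \<Rightarrow> real" where
  "dist_quat x y = norm (x - y)"

definition
  "(uniformity :: (quat \<times> quat) filter) = (INF e\<in>{0 <..}. principal {(x, y). dist x y < e})"

definition
  "open (U :: quat set) \<longleftrightarrow> (\<forall>x\<in>U. eventually (\<lambda>(x', y). x' = x \<longrightarrow> y \<in> U) uniformity)"

instance
proof
  fix x y z :: quat and r :: real and S :: "quat set"
  show "dist x y = norm (x - y)" by (rule dist_quat_def)
  show "sgn x = x /\<^sub>R norm x" by (rule sgn_quat_def)
  show "(uniformity :: (quat \<times> quat) filter) = (INF e\<in>{0 <..}. principal {(x, y). dist x y < e})"
    by (rule uniformity_quat_def)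
  show "open S \<longleftrightarrow> (\<forall>x\<in>S. \<forall>\<^sub>F (x', y) in uniformity. x' = x \<longrightarrow> y \<in> S)"
    by (rule open_quat_def)
  show "inner x y = inner y x" by (simp add: inner_quat_def mult.commute)
  show "inner (x + y) z = inner x z + inner y z" by (simp add: inner_quat_def algebra_simps)
  show "inner (scaleR r x) y = r * inner x y" by (simp add: inner_quat_def algebra_simps)
  show "0 \<le> inner x x" by (simp add: inner_quat_def)
  show "inner x x = 0 \<longleftrightarrow> x = 0"
    by (simp add: inner_quat_def quat_eq_iff add_nonneg_eq_0_iff)
  show "norm x = sqrt (inner x x)" by (rule norm_quat_def)
qed

end

instantiation quat :: real_normed_div_algebra
begin

primcorec inverse_quat where
  "qRe (inverse x) = qRe x / inner x x"
| "qI (inverse x) = - qI x / inner x x"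
| "qJ (inverse x) = - qJ x / inner x x"
| "qK (inverse x) = - qK x / inner x x"

definition divide_quat :: "quat \<Rightarrow> quat \<Rightarrow> quat" where
  "divide_quat x y = x * inverse y"

instance
proof
  fix x y :: quat
  have n: "qRe x * qRe x / inner x x + qI x * qI x / inner x x + qJ x * qJ x / inner x x
      + qK x * qK x / inner x x = 1" if "x \<noteq> 0"
  proof -
    have "inner x x \<noteq> 0" using that by simp
    then show ?thesis
      by (simp only: add_divide_distrib [symmetric] inner_quat_def [of x x, symmetric]) simp
  qed
  show "inverse x * x = 1" if "x \<noteq> 0"
    using n [OF that] by (simp only: quat_eq_iff times_quat.simps inverse_quat.simps one_quat.simps)
      (simp add: mult.commute)
  show "x * inverse x = 1" if "x \<noteq> 0"
    using n [OF that] by (simp only: quat_eq_iff times_quat.simps inverse_quat.simps one_quat.simps)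
      (simp add: mult.commute)
  show "x div y = x * inverse y" by (rule divide_quat_def)
  show "inverse (0 :: quat) = 0" by (simp add: quat_eq_iff)
  have "inner (x * y) (x * y) = inner x x * inner y y"
    unfolding inner_quat_def times_quat.simps by algebra
  then show "norm (x * y) = norm x * norm y"
    by (simp add: norm_quat_def real_sqrt_mult)
qed

end

instantiation quat :: euclidean_space
begin

definition Basis_quat :: "quat set" where
  "Basis_quat = {Quat 1 0 0 0, Quat 0 1 0 0, Quat 0 0 1 0, Quat 0 0 0 1}"

instance
proof
  fix u v x :: quat
  show "(Basis :: quat set) \<noteq> {}" "finite (Basis :: quat set)"
    by (simp_all add: Basis_quat_def)
  show "inner u v = (if u = v then 1 else 0)" if "u \<in> Basis" "v \<in> Basis"
    using that unfolding Basis_quat_def by (elim insertE emptyE) (simp_all add: inner_quat_def)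
  show "(\<forall>u\<in>Basis. inner x u = 0) \<longleftrightarrow> x = 0"
    by (simp add: Basis_quat_def inner_quat_def) (simp add: quat_eq_iff)
qed

end


section \<open>Slice regular functions\<close>

definition imag_units :: "quat set" where
  "imag_units = {q. q\<^sup>2 = -1}"

definition slice_embed :: "quat \<Rightarrow> complex \<Rightarrow> quat" where
  "slice_embed I z = of_real (Re z) + of_real (Im z) * I"

definition slice_plane :: "quat \<Rightarrow> quat set" where
  "slice_plane I = {of_real x + of_real y * I | x y. True}"

definition slice_open :: "quat set \<Rightarrow> bool" where
  "slice_open \<Omega> \<longleftrightarrow>
     (\<forall>I\<in>imag_units. openin (top_of_set (slice_plane I)) (\<Omega> \<inter> slice_plane I))"

text \<open>In the next definition \<open>U\<close> is meant to be open in \<open>slice_plane I\<close>; then both partial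
  derivatives depend only on the restriction of \<open>h\<close> to \<open>U\<close>.
  The functions \<open>hx\<close> and \<open>hy\<close> are \<open>\<partial>h/\<partial>x\<close> and \<open>\<partial>h/\<partial>y\<close>, viewed as functions of the point
  \<open>x + y I\<close>; the imaginary unit multiplies from the left.\<close>

definition left_holomorphic_on :: "quat \<Rightarrow> (quat \<Rightarrow> quat) \<Rightarrow> quat set \<Rightarrow> bool" where
  "left_holomorphic_on I h U \<longleftrightarrow>
     (\<exists>hx hy. continuous_on U hx \<and> continuous_on U hy \<and>
        (\<forall>x y. of_real x + of_real y * I \<in> U \<longrightarrow>
           ((\<lambda>s. h (of_real s + of_real y * I))
              has_vector_derivative hx (of_real x + of_real y * I)) (at x) \<and>
           ((\<lambda>t. h (of_real x + of_real t * I))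
              has_vector_derivative hy (of_real x + of_real y * I)) (at y) \<and>
           (1/2) * (hx (of_real x + of_real y * I) + I * hy (of_real x + of_real y * I)) = 0))"

text \<open>A function on \<open>\<Omega>\<close> is modelled by a total function whose values outside \<open>\<Omega>\<close> are
  irrelevant.\<close>

definition slice_regular_on :: "(quat \<Rightarrow> quat) \<Rightarrow> quat set \<Rightarrow> bool" where
  "slice_regular_on f \<Omega> \<longleftrightarrow>
     (\<forall>I\<in>imag_units. left_holomorphic_on I f (\<Omega> \<inter> slice_plane I))"

end

theory Submission
  imports Defs "HOL-Complex_Analysis.Conformal_Mappings"
begin

text \<open>The difference of the two sides, as a function of a complex variable, satisfies the
  Cauchy--Riemann equation for left multiplication by \<open>I\<close>: with \<open>A = (I - K) (J - K)\<^sup>-\<^sup>1\<close> and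
  \<open>B = (I - J) (K - J)\<^sup>-\<^sup>1\<close> one has \<open>I A = A J\<close> and \<open>I B = B K\<close>. It vanishes at real points because
  \<open>A + B = 1\<close>. The complex functionals \<open>q \<mapsto> \<langle>q, v\<rangle> - i \<langle>I q, v\<rangle>\<close> turn it into ordinary holomorphic
  functions vanishing on a real interval around \<open>\<gamma>(0)\<close>, so it vanishes on the connected component
  containing \<open>\<gamma>\<close>.\<close>

text \<open>Existence of both partial derivatives, with \<open>uy\<close> continuous, gives total
  real differentiability by \<open>has_derivative_partialsI\<close>; the Cauchy-Riemann equation
  then makes the differential complex linear.\<close>

lemma holomorphic_on_partialsI:
  fixes u ux uy :: "complex \<Rightarrow> complex"
  assumes W: "open W" and cont: "continuous_on W uy"
    and ux: "\<And>z. z \<in> W \<Longrightarrow> ((\<lambda>s. u (Complex s (Im z))) has_vector_derivative ux z) (at (Re z))"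
    and uy: "\<And>z. z \<in> W \<Longrightarrow> ((\<lambda>t. u (Complex (Re z) t)) has_vector_derivative uy z) (at (Im z))"
    and CR: "\<And>z. z \<in> W \<Longrightarrow> uy z = \<i> * ux z"
  shows "u holomorphic_on W"
proof -
  have "(u has_field_derivative ux z) (at z)" if z: "z \<in> W" for z
  proof -
    have cC: "continuous_on UNIV (\<lambda>p. Complex (fst p) (snd p))"
      unfolding Complex_eq by (intro continuous_intros)
    have "open ((\<lambda>p. Complex (fst p) (snd p)) -` W)"
      using open_vimage [OF W cC] .
    then obtain A B where AB: "open A" "open B" "(Re z, Im z) \<in> A \<times> B"
      "A \<times> B \<subseteq> (\<lambda>p. Complex (fst p) (snd p)) -` W"
      using z by (elim open_prod_elim [of _ "(Re z, Im z)"]) auto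
    then obtain d where d: "d > 0" "ball (Im z) d \<subseteq> B"
      by (meson mem_Sigma_iff openE)
    \<comment> \<open>\<open>has_derivative_partialsI\<close> needs a convex second factor, so
      \<open>B\<close> is shrunk to an interval around \<open>Im z\<close>.\<close>
    define Y where "Y = ball (Im z) d"
    have mem: "Complex x y \<in> W" if "x \<in> A" "y \<in> Y" for x y
      using subsetD [OF AB(4), of "(x, y)"] d that by (auto simp: Y_def)
    have *: "Re z \<in> A" "Im z \<in> Y" "open (A \<times> Y)" "convex Y"
      using AB d by (auto simp: Y_def intro: open_Times)
    \<comment> \<open>The partial derivative in \<open>y\<close> is wanted as a continuously varying
      bounded linear map; \<open>blinfun_scaleR_left v\<close> is the map sending \<open>t\<close>
      to \<open>t *\<^sub>R v\<close>.\<close>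
    have cAY: "continuous_on (A \<times> Y) (\<lambda>(x, y). blinfun_scaleR_left (uy (Complex x y)))"
    proof -
      have "continuous_on (A \<times> Y) (\<lambda>p. uy (Complex (fst p) (snd p)))"
        using mem by (intro continuous_on_compose2 [OF cont continuous_on_subset [OF cC]]) auto
      then show ?thesis
        by (auto simp: case_prod_unfold
            intro!: bounded_linear.continuous_on [OF bounded_linear_blinfun_scaleR_left])
    qed
    have "((\<lambda>(x, y). u (Complex x y)) has_derivative
        (\<lambda>(tx, ty). tx *\<^sub>R ux z + blinfun_scaleR_left (uy (Complex (Re z) (Im z))) ty))
        (at (Re z, Im z) within A \<times> Y)"
    proof (rule has_derivative_partialsI)
      show "((\<lambda>x. u (Complex x (Im z))) has_derivative (\<lambda>s. s *\<^sub>R ux z)) (at (Re z) within A)"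
        using ux [OF z] by (auto simp: has_vector_derivative_def intro: has_derivative_at_withinI)
      show "((\<lambda>y. u (Complex x y)) has_derivative blinfun_scaleR_left (uy (Complex x y)))
          (at y within Y)" if "x \<in> A" "y \<in> Y" for x y
        using uy [OF mem [OF that]]
        by (auto simp: has_vector_derivative_def intro: has_derivative_at_withinI)
      show "continuous (at (Re z, Im z) within A \<times> Y)
          (\<lambda>(x, y). blinfun_scaleR_left (uy (Complex x y)))"
        using cAY * by (simp add: continuous_on_eq_continuous_within)
    qed (use * in auto)
    then have D: "((\<lambda>(x, y). u (Complex x y)) has_derivative
        (\<lambda>(tx, ty). tx *\<^sub>R ux z + ty *\<^sub>R uy z)) (at (Re z, Im z))"
      using * by (simp add: at_within_open [of _ "A \<times> Y"])
    have "((\<lambda>z. (Re z, Im z)) has_derivative (\<lambda>h. (Re h, Im h))) (at z)"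
      by (intro derivative_eq_intros | rule refl)+
    from has_derivative_compose [OF this D]
    have "(u has_derivative (\<lambda>h. Re h *\<^sub>R ux z + Im h *\<^sub>R uy z)) (at z)"
      by simp
    moreover have "(\<lambda>h. Re h *\<^sub>R ux z + Im h *\<^sub>R uy z) = (*) (ux z)"
      using CR [OF z] by (auto simp: fun_eq_iff complex_eq_iff algebra_simps)
    ultimately show ?thesis
      by (simp add: has_field_derivative_def)
  qed
  then show ?thesis
    using W by (auto simp: holomorphic_on_open)
qed

lemma slice_embed_eq: "slice_embed L (Complex x y) = of_real x + of_real y * L"
  by (simp add: slice_embed_def)

lemma slice_embed_in_slice_plane: "slice_embed L z \<in> slice_plane L"
  by (auto simp: slice_embed_def slice_plane_def)

lemma continuous_on_slice_embed: "continuous_on S (slice_embed L)"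
  unfolding slice_embed_def by (intro continuous_intros)

lemma open_slice_vimage:
  assumes "slice_open \<Omega>" "L \<in> imag_units"
  shows "open (slice_embed L -` \<Omega>)"
proof -
  \<comment> \<open>Slice-openness only speaks of relatively open subsets of
    \<open>slice_plane L\<close>. Since \<open>slice_embed L\<close> takes its values there,
    intersecting with the plane does not change the preimage.\<close>
  have "openin (top_of_set UNIV) (UNIV \<inter> slice_embed L -` (\<Omega> \<inter> slice_plane L))"
    using assms
    by (intro continuous_openin_preimage [OF continuous_on_slice_embed, of _ _ "slice_plane L"])
      (auto simp: slice_open_def slice_embed_in_slice_plane)
  then show ?thesis
    by (simp add: vimage_Int slice_embed_in_slice_plane vimage_def)
qed

lemma imag_units_square: "I \<in> imag_units \<Longrightarrow> I * I = -1"
  by (simp add: imag_units_def power2_eq_square)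

text \<open>Moves regularity on the slice of \<open>L\<close> to complex coordinates, so that
  restrictions to different slices can be compared on a common open subset of the complex
  plane.\<close>

lemma slice_partialsE:
  assumes reg: "slice_regular_on f \<Omega>" and L: "L \<in> imag_units"
  obtains Fx Fy where
    "continuous_on (slice_embed L -` \<Omega>) Fy"
    "\<And>z. slice_embed L z \<in> \<Omega> \<Longrightarrow>
      ((\<lambda>s. f (slice_embed L (Complex s (Im z)))) has_vector_derivative Fx z) (at (Re z))"
    "\<And>z. slice_embed L z \<in> \<Omega> \<Longrightarrow>
      ((\<lambda>t. f (slice_embed L (Complex (Re z) t))) has_vector_derivative Fy z) (at (Im z))"
    "\<And>z. slice_embed L z \<in> \<Omega> \<Longrightarrow> Fy z = L * Fx z"
proof -
  from reg L have "left_holomorphic_on L f (\<Omega> \<inter> slice_plane L)"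
    by (simp add: slice_regular_on_def)
  then obtain hx hy where h: "continuous_on (\<Omega> \<inter> slice_plane L) hy"
    and hd: "\<And>x y. of_real x + of_real y * L \<in> \<Omega> \<inter> slice_plane L \<Longrightarrow>
           ((\<lambda>s. f (of_real s + of_real y * L))
              has_vector_derivative hx (of_real x + of_real y * L)) (at x) \<and>
           ((\<lambda>t. f (of_real x + of_real t * L))
              has_vector_derivative hy (of_real x + of_real y * L)) (at y) \<and>
           (1/2) * (hx (of_real x + of_real y * L) + L * hy (of_real x + of_real y * L)) = 0"
    unfolding left_holomorphic_on_def by blast
  have d: "((\<lambda>s. f (slice_embed L (Complex s (Im z)))) has_vector_derivative hx (slice_embed L z)) (at (Re z))"
    "((\<lambda>t. f (slice_embed L (Complex (Re z) t))) has_vector_derivative hy (slice_embed L z)) (at (Im z))"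
    "hy (slice_embed L z) = L * hx (slice_embed L z)"
    if "slice_embed L z \<in> \<Omega>" for z
  proof -
    have e: "slice_embed L z = of_real (Re z) + of_real (Im z) * L"
      by (simp add: slice_embed_def)
    note * = hd [of "Re z" "Im z", folded e]
    have **: "slice_embed L z \<in> \<Omega> \<inter> slice_plane L"
      using that slice_embed_in_slice_plane by auto
    show "((\<lambda>s. f (slice_embed L (Complex s (Im z)))) has_vector_derivative hx (slice_embed L z)) (at (Re z))"
      "((\<lambda>t. f (slice_embed L (Complex (Re z) t))) has_vector_derivative hy (slice_embed L z)) (at (Im z))"
      using * [OF **] by (auto simp: slice_embed_eq)
    \<comment> \<open>Multiplying this equation by \<open>L\<close> from the left and using
      \<open>L * L = -1\<close> solves it for \<open>hy\<close>.\<close>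
    have "hx (slice_embed L z) = - (L * hy (slice_embed L z))"
      using * [OF **] by (simp add: eq_neg_iff_add_eq_0)
    then show "hy (slice_embed L z) = L * hx (slice_embed L z)"
      using imag_units_square [OF L] by (simp add: mult.assoc [symmetric])
  qed
  show thesis
  proof (rule that [of "\<lambda>z. hy (slice_embed L z)" "\<lambda>z. hx (slice_embed L z)"])
    show "continuous_on (slice_embed L -` \<Omega>) (\<lambda>z. hy (slice_embed L z))"
      by (rule continuous_on_compose2 [OF h continuous_on_slice_embed])
        (auto simp: slice_embed_in_slice_plane)
  qed (fact d)+
qed

text \<open>An identity theorem for quaternion-valued functions: enough real-linear maps to the
  complex numbers carry left multiplication by \<open>I\<close> to multiplication by
  \<open>\<i>\<close>, and to each composite the classical theorem applies.\<close>

lemma slice_identity_principle: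
  fixes g gx gy :: "complex \<Rightarrow> quat"
  assumes I: "I \<in> imag_units" and W: "open W" "connected W" and cont: "continuous_on W gy"
    and gx: "\<And>z. z \<in> W \<Longrightarrow> ((\<lambda>s. g (Complex s (Im z))) has_vector_derivative gx z) (at (Re z))"
    and gy: "\<And>z. z \<in> W \<Longrightarrow> ((\<lambda>t. g (Complex (Re z) t)) has_vector_derivative gy z) (at (Im z))"
    and CR: "\<And>z. z \<in> W \<Longrightarrow> gy z = I * gx z"
    and z0: "z0 \<in> W \<inter> \<real>" and zero: "\<And>z. z \<in> W \<inter> \<real> \<Longrightarrow> g z = 0"
    and w: "w \<in> W"
  shows "g w = 0"
proof -
  have "inner (g w) v = 0" for v
  proof -
    \<comment> \<open>The real part tests \<open>q\<close> against \<open>v\<close>; the imaginary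
      part is then forced by the requirement \<open>p (I * q) = \<i> * p q\<close>.\<close>
    define p where "p q = of_real (inner q v) - \<i> * of_real (inner (I * q) v)" for q
    have bl: "bounded_linear p"
      unfolding p_def
      by (intro bounded_linear_intros bounded_linear_sub
          bounded_linear_compose [OF bounded_linear_of_real]
          bounded_linear_compose [OF bounded_linear_mult_right] bounded_linear_inner_left_comp)
    have pI: "p (I * q) = \<i> * p q" for q
      using imag_units_square [OF I]
      by (simp add: p_def mult.assoc [symmetric] complex_eq_iff)
    have hol: "(\<lambda>z. p (g z)) holomorphic_on W"
    proof (rule holomorphic_on_partialsI [OF W(1)])
      show "continuous_on W (\<lambda>z. p (gy z))"
        by (rule bounded_linear.continuous_on [OF bl cont])
      show "((\<lambda>s. p (g (Complex s (Im z)))) has_vector_derivative p (gx z)) (at (Re z))"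
        if "z \<in> W" for z
        by (rule bounded_linear.has_vector_derivative [OF bl gx [OF that]])
      show "((\<lambda>t. p (g (Complex (Re z) t))) has_vector_derivative p (gy z)) (at (Im z))"
        if "z \<in> W" for z
        by (rule bounded_linear.has_vector_derivative [OF bl gy [OF that]])
    qed (simp add: CR pI)
    have "z0 islimpt W \<inter> \<real>"
      unfolding islimpt_approachable
    proof (intro allI impI)
      fix e :: real assume "0 < e"
      obtain d where d: "d > 0" "ball z0 d \<subseteq> W"
        using W(1) z0 openE by blast
      \<comment> \<open>The real shift \<open>z0 + r\<close> stays real, remains in \<open>W\<close>
        because \<open>r < d\<close>, and is closer than \<open>e\<close> to
        \<open>z0\<close>.\<close>
      define r where "r = min d e / 2"
      have r: "0 < r" "r < d" "r < e"
        using d \<open>0 < e\<close> by (auto simp: r_def)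
      show "\<exists>x'\<in>W \<inter> \<real>. x' \<noteq> z0 \<and> dist x' z0 < e"
        using z0 d r by (intro bexI [of _ "z0 + of_real r"]) (auto simp: dist_norm)
    qed
    then have "p (g w) = 0"
      by (rule analytic_continuation [OF hol W _ _ _ _ w, rotated 2])
        (use z0 zero linear_0 [OF bounded_linear.linear [OF bl]] in auto)
    then show ?thesis
      by (simp add: p_def complex_eq_iff)
  qed
  then show ?thesis
    \<comment> \<open>Take \<open>v = g w\<close>.\<close>
    by (metis inner_eq_zero_iff)
qed

text \<open>Both \<open>X = I\<close> and \<open>X = J\<close> satisfy
  \<open>X * (X - K) = - ((X - K) * K)\<close>, as each side equals \<open>-1 - X * K\<close>. Thus
  \<open>I - K\<close> and \<open>J - K\<close> both intertwine with \<open>-K\<close>, and the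
  quotient intertwines \<open>I\<close> with \<open>J\<close>.\<close>

lemma imag_units_intertwine:
  assumes "I \<in> imag_units" "J \<in> imag_units" "K \<in> imag_units" "J \<noteq> K"
  shows "I * ((I - K) * inverse (J - K)) = (I - K) * inverse (J - K) * J"
proof -
  have eq: "X * (X - K) = - ((X - K) * K)" if "X \<in> imag_units" for X
    using imag_units_square [OF that] imag_units_square [OF assms(3)] by (simp add: algebra_simps)
  have nz: "J - K \<noteq> 0"
    using assms(4) by simp
  \<comment> \<open>Inserting \<open>(J - K) * inverse (J - K)\<close> on the right makes
    \<open>eq\<close> applicable to \<open>J\<close>.\<close>
  have "inverse (J - K) * J = inverse (J - K) * (J * (J - K)) * inverse (J - K)"
    using nz by (simp add: mult.assoc)
  also have "\<dots> = - (K * inverse (J - K))"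
    using nz by (simp add: eq [OF assms(2)] mult.assoc [symmetric])
  finally have "(I - K) * inverse (J - K) * J = - ((I - K) * K) * inverse (J - K)"
    by (simp add: mult.assoc)
  then show ?thesis
    by (simp add: eq [OF assms(1), symmetric] mult.assoc)
qed

theorem theorem2p11:
  fixes \<Omega> :: "quat set" and \<gamma> :: "real \<Rightarrow> complex"
    and I J K :: quat and f :: "quat \<Rightarrow> quat"
  assumes "slice_open \<Omega>"
    and "path \<gamma>" and "\<gamma> 0 \<in> \<real>"
    and "I \<in> imag_units" and "J \<in> imag_units" and "K \<in> imag_units" and "J \<noteq> K"
    and "path_image (slice_embed I \<circ> \<gamma>) \<subseteq> \<Omega>"
    and "path_image (slice_embed J \<circ> \<gamma>) \<subseteq> \<Omega>"
    and "path_image (slice_embed K \<circ> \<gamma>) \<subseteq> \<Omega>"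
    and "slice_regular_on f \<Omega>"
  shows "\<forall>t\<in>{0..1}.
    (f \<circ> (slice_embed I \<circ> \<gamma>)) t =
      (I - K) * inverse (J - K) * (f \<circ> (slice_embed J \<circ> \<gamma>)) t +
      (I - J) * inverse (K - J) * (f \<circ> (slice_embed K \<circ> \<gamma>)) t"
proof -
  define A where "A = (I - K) * inverse (J - K)"
  define B where "B = (I - J) * inverse (K - J)"
  \<comment> \<open>The equation for \<open>B\<close> is the one for \<open>A\<close> with
    \<open>J\<close> and \<open>K\<close> exchanged.\<close>
  have IA: "I * A = A * J" and IB: "I * B = B * K"
    using imag_units_intertwine assms(4-7) by (auto simp: A_def B_def)
  have "inverse (K - J) = - inverse (J - K)"
    using assms(7) by (simp flip: inverse_minus_eq)
  then have "A + B = (J - K) * inverse (J - K)"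
    by (simp add: A_def B_def algebra_simps)
  then have AB: "A + B = 1"
    using assms(7) by simp
  define D where "D = slice_embed I -` \<Omega> \<inter> slice_embed J -` \<Omega> \<inter> slice_embed K -` \<Omega>"
  \<comment> \<open>\<open>D\<close> need not be connected. Its component through
    \<open>\<gamma> 0\<close> is open, meets the real axis there and contains the whole
    path.\<close>
  define W where "W = connected_component_set D (\<gamma> 0)"
  have "open D"
    using open_slice_vimage assms(1,4-6) by (auto simp: D_def)
  have W: "open W" "connected W" "W \<subseteq> D"
    using open_connected_component [OF \<open>open D\<close>]
    by (auto simp: W_def connected_component_subset)
  have "path_image \<gamma> \<subseteq> D"
    using assms(8-10) by (auto simp: D_def path_image_def)
  then have \<gamma>W: "path_image \<gamma> \<subseteq> W"
    unfolding W_def using connected_path_image [OF assms(2)]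
    by (intro connected_component_maximal) (auto simp: path_image_def)
  obtain Ix Iy where
    I: "continuous_on (slice_embed I -` \<Omega>) Iy"
    "\<And>z. slice_embed I z \<in> \<Omega> \<Longrightarrow>
      ((\<lambda>s. f (slice_embed I (Complex s (Im z)))) has_vector_derivative Ix z) (at (Re z))"
    "\<And>z. slice_embed I z \<in> \<Omega> \<Longrightarrow>
      ((\<lambda>t. f (slice_embed I (Complex (Re z) t))) has_vector_derivative Iy z) (at (Im z))"
    "\<And>z. slice_embed I z \<in> \<Omega> \<Longrightarrow> Iy z = I * Ix z"
    by (rule slice_partialsE [OF assms(11,4)]) (rule that)
  obtain Jx Jy where
    J: "continuous_on (slice_embed J -` \<Omega>) Jy"
    "\<And>z. slice_embed J z \<in> \<Omega> \<Longrightarrow>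
      ((\<lambda>s. f (slice_embed J (Complex s (Im z)))) has_vector_derivative Jx z) (at (Re z))"
    "\<And>z. slice_embed J z \<in> \<Omega> \<Longrightarrow>
      ((\<lambda>t. f (slice_embed J (Complex (Re z) t))) has_vector_derivative Jy z) (at (Im z))"
    "\<And>z. slice_embed J z \<in> \<Omega> \<Longrightarrow> Jy z = J * Jx z"
    by (rule slice_partialsE [OF assms(11,5)]) (rule that)
  obtain Kx Ky where
    K: "continuous_on (slice_embed K -` \<Omega>) Ky"
    "\<And>z. slice_embed K z \<in> \<Omega> \<Longrightarrow>
      ((\<lambda>s. f (slice_embed K (Complex s (Im z)))) has_vector_derivative Kx z) (at (Re z))"
    "\<And>z. slice_embed K z \<in> \<Omega> \<Longrightarrow>
      ((\<lambda>t. f (slice_embed K (Complex (Re z) t))) has_vector_derivative Ky z) (at (Im z))"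
    "\<And>z. slice_embed K z \<in> \<Omega> \<Longrightarrow> Ky z = K * Kx z"
    by (rule slice_partialsE [OF assms(11,6)]) (rule that)
  have mem: "slice_embed I z \<in> \<Omega>" "slice_embed J z \<in> \<Omega>" "slice_embed K z \<in> \<Omega>" if "z \<in> W" for z
    using that W(3) by (auto simp: D_def)
  have *: "f (slice_embed I z) - A * f (slice_embed J z) - B * f (slice_embed K z) = 0"
    if z: "z \<in> W" for z
  proof (rule slice_identity_principle [OF assms(4) W(1,2) _ _ _ _ _ _ z])
    show "continuous_on W (\<lambda>z. Iy z - A * Jy z - B * Ky z)"
      by (intro continuous_intros continuous_on_subset [OF I(1)] continuous_on_subset [OF J(1)]
          continuous_on_subset [OF K(1)]) (auto simp: mem)
    show "((\<lambda>s. f (slice_embed I (Complex s (Im z))) - A * f (slice_embed J (Complex s (Im z)))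
        - B * f (slice_embed K (Complex s (Im z)))) has_vector_derivative
          Ix z - A * Jx z - B * Kx z) (at (Re z))" if "z \<in> W" for z
      by (intro has_vector_derivative_diff has_vector_derivative_mult_right I J K mem that)
    show "((\<lambda>t. f (slice_embed I (Complex (Re z) t)) - A * f (slice_embed J (Complex (Re z) t))
        - B * f (slice_embed K (Complex (Re z) t))) has_vector_derivative
          Iy z - A * Jy z - B * Ky z) (at (Im z))" if "z \<in> W" for z
      by (intro has_vector_derivative_diff has_vector_derivative_mult_right I J K mem that)
    \<comment> \<open>The coefficients stand on the left, so
      \<open>A * Jy z = A * J * Jx z = I * A * Jx z\<close>, and likewise for
      \<open>B\<close>.\<close>
    show "Iy z - A * Jy z - B * Ky z = I * (Ix z - A * Jx z - B * Kx z)" if "z \<in> W" for z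
      using I(4) J(4) K(4) mem [OF that]
      by (simp add: right_diff_distrib mult.assoc [symmetric] IA IB)
    show "\<gamma> 0 \<in> W \<inter> \<real>"
      using assms(3) \<gamma>W by (auto simp: path_image_def)
    show "f (slice_embed I z) - A * f (slice_embed J z) - B * f (slice_embed K z) = 0"
      if "z \<in> W \<inter> \<real>" for z
    proof -
      \<comment> \<open>All slices share the real axis: at a real point the three values of
        \<open>f\<close> coincide, and the difference is \<open>1 - (A + B)\<close> times this
        value.\<close>
      have "slice_embed L z = of_real (Re z)" for L
        using that by (simp add: slice_embed_def complex_is_Real_iff)
      moreover have "q - A * q - B * q = (1 - (A + B)) * q" for q
        by (simp add: algebra_simps)
      ultimately show ?thesis
        by (simp add: AB)
    qed
  qed
  have "\<gamma> t \<in> W" if "t \<in> {0..1}" for t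
    using \<gamma>W that by (auto simp: path_image_def)
  then show ?thesis
    using * unfolding A_def B_def by (auto simp: algebra_simps)
qed

end
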